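(* Let the diamond graph be the graph on vertices $d_1,d_2,d_3,d_4$ with edges $d_1d_2$, $d_1d_3$, $d_2d_3$, $d_2d_4$, $d_3d_4$ (i.e. $K_4$ minus the edge $d_1d_4$). Let $H$ be the $(d_1,2)$-ordering of the diamond graph. Then $R_<(H)\le 16$.
   Context: A $k$-ordering of a graph $H$ assigns distinct order-labels from $\{1,\ldots,|H|\}$ to $k$ of the vertices of $H$. For a vertex $v$ of $H$ and $1\le l\le |H|$, the $(v,l)$-ordering of $H$ is the 1-ordering in which $v$ receives order-label $l$ and no other vertex is labeled. An ordered 2-coloring on $n$ vertices is a red/blue coloring of the edges of the complete graph on vertex set $\{1,\ldots,n\}$. It contains a $k$-ordering $H$ (in a given color) if it has a subgraph isomorphic to $H$, all of whose edges have that color, such that for every $i$ the $i$-th smallest vertex of the copy corresponds to a vertex of $H$ that has order-label $i$ or no order-label. $R_<(H)$ is the least $n$ such that every ordered 2-coloring on $n$ vertices contains a monochromatic (red or blue) copy of $H$. *)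

theory Defs
  imports Main "HOL-Library.Extended_Nat"
begin

record 'a graph =
  verts :: "'a set"
  edges :: "'a set set"

definition simple_graph :: "('a, 'b) graph_scheme \<Rightarrow> bool" where
  "simple_graph G \<longleftrightarrow> finite (verts G) \<and> (\<forall>e\<in>edges G. e \<subseteq> verts G \<and> card e = 2)"

text \<open>A graph together with a partial labelling of its vertices; \<open>None\<close> means unlabelled.\<close>

record 'a ordering = "'a graph" +
  order_label :: "'a \<Rightarrow> nat option"

definition k_ordering :: "nat \<Rightarrow> 'a ordering \<Rightarrow> bool" where
  "k_ordering k H \<longleftrightarrow> simple_graph H
     \<and> dom (order_label H) \<subseteq> verts H \<and> card (dom (order_label H)) = k
     \<and> ran (order_label H) \<subseteq> {1..card (verts H)}
     \<and> inj_on (order_label H) (dom (order_label H))"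

definition vl_ordering :: "'a graph \<Rightarrow> 'a \<Rightarrow> nat \<Rightarrow> 'a ordering" where
  "vl_ordering G v l = \<lparr>verts = verts G, edges = edges G, order_label = [v \<mapsto> l]\<rparr>"

lemma k_ordering_vl_ordering:
  assumes "simple_graph G" "v \<in> verts G" "1 \<le> l" "l \<le> card (verts G)"
  shows "k_ordering 1 (vl_ordering G v l)"
  using assms by (auto simp: k_ordering_def vl_ordering_def simple_graph_def)

datatype color = Red | Blue

text \<open>
  An ordered 2-coloring on \<open>n\<close> vertices is given by a function \<open>c :: nat set \<Rightarrow> color\<close>, of which
  only the values on the 2-element subsets of \<open>{1..n}\<close> matter. The map \<open>f\<close> below is the
  isomorphism from \<open>H\<close> onto the copy, and the \<open>i\<close>-th smallest vertex of the copy is at position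
  \<open>i - 1\<close> of the sorted list of its vertices.
\<close>

definition contains_in_color :: "nat \<Rightarrow> (nat set \<Rightarrow> color) \<Rightarrow> color \<Rightarrow> 'a ordering \<Rightarrow> bool" where
  "contains_in_color n c col H \<longleftrightarrow>
     (\<exists>f. inj_on f (verts H) \<and> f ` verts H \<subseteq> {1..n}
        \<and> (\<forall>e\<in>edges H. c (f ` e) = col)
        \<and> (\<forall>i\<in>{1..card (verts H)}. \<forall>v\<in>verts H.
             f v = sorted_list_of_set (f ` verts H) ! (i - 1) \<longrightarrow>
             order_label H v = Some i \<or> order_label H v = None))"

text \<open>The value is \<open>\<infinity>\<close> if no suitable \<open>n\<close> exists.\<close>

definition ordered_ramsey :: "'a ordering \<Rightarrow> enat"  (\<open>R\<^sub><\<close>) where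
  "R\<^sub>< H = Inf {enat n | n. \<forall>c. \<exists>col. contains_in_color n c col H}"

datatype diamond_vertex = d1 | d2 | d3 | d4

definition diamond :: "diamond_vertex graph" where
  "diamond = \<lparr>verts = {d1, d2, d3, d4},
              edges = {{d1, d2}, {d1, d3}, {d2, d3}, {d2, d4}, {d3, d4}}\<rparr>"

lemma k_ordering_diamond: "k_ordering 1 (vl_ordering diamond d1 2)"
  by (rule k_ordering_vl_ordering) (auto simp: simple_graph_def diamond_def)

end

theory Submission
  imports Defs
begin

text \<open>
  Two monochromatic triangles \<open>a < c < d\<close> and \<open>b < c < d\<close> with \<open>a < b\<close> share the edge \<open>cd\<close>, hence
  the color, and form a copy of the diamond in which \<open>b\<close>, the second smallest vertex, has degree 2.
  If there is no such copy, a monochromatic triangle is thus determined by its two largest vertices,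
  so a coloring on \<open>{1..16}\<close> has at most \<open>15 choose 2 = 105\<close> monochromatic triangles. But by
  Goodman's bound it has at least 112.
\<close>

definition mono_triple :: "('a set \<Rightarrow> color) \<Rightarrow> 'a \<Rightarrow> 'a \<Rightarrow> 'a \<Rightarrow> bool" where
  "mono_triple c i j k \<longleftrightarrow>
     i \<noteq> j \<and> j \<noteq> k \<and> i \<noteq> k \<and> c {i, j} = c {j, k} \<and> c {j, k} = c {i, k}"

text \<open>A product with fixed sum \<open>2 * m - 1\<close> is largest at the balanced split
  \<open>m\<close>, \<open>m - 1\<close>. If the smaller factor is \<open>x = m - 1 - t\<close>, the
  deficit is \<open>t * t + t\<close>. This serves to bound red degree times blue degree at a
  vertex.\<close>

lemma mult_le_of_add_odd:
  fixes r b m :: nat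
  assumes "r + b + 1 = 2 * m"
  shows "r * b \<le> m * (m - 1)"
proof -
  have bound: "x * y \<le> m * (m - 1)" if "x < m" "x + y + 1 = 2 * m" for x y
  proof -
    define t where "t = m - Suc x"
    have "m = x + Suc t" "y = x + 2 * t + 1"
      using that by (simp_all add: t_def)
    then show ?thesis by (simp add: algebra_simps)
  qed
  have "r < m \<or> b < m" using assms by linarith
  then show ?thesis
    using bound[of r b] bound[of b r] assms by (auto simp: ac_simps)
qed

lemma card_distinct_triples:
  assumes "finite V"
  shows "card {(i, j, k). i \<in> V \<and> j \<in> V \<and> k \<in> V \<and> i \<noteq> j \<and> j \<noteq> k \<and> i \<noteq> k}
         = card V * (card V - 1) * (card V - 2)"
proof -
  have "{(i, j, k). i \<in> V \<and> j \<in> V \<and> k \<in> V \<and> i \<noteq> j \<and> j \<noteq> k \<and> i \<noteq> k}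
        = Sigma V (\<lambda>i. Sigma (V - {i}) (\<lambda>j. V - {i, j}))"
    by auto
  also have "card \<dots> = (\<Sum>i\<in>V. \<Sum>j\<in>V - {i}. card (V - {i, j}))"
    using assms by simp
  also have "\<dots> = (\<Sum>i\<in>V. \<Sum>j\<in>V - {i}. card V - 2)"
    using assms by (intro sum.cong refl) (auto simp: card_Diff_subset)
  finally show ?thesis using assms by simp
qed

text \<open>Each unordered triangle is counted six times here.\<close>

lemma goodman:
  fixes V :: "'a set"
  assumes fin: "finite V" and card: "card V = 2 * m"
  shows "2 * m * (m - 1) * (m - 2)
         \<le> card {(i, j, k). i \<in> V \<and> j \<in> V \<and> k \<in> V \<and> mono_triple c i j k}"
    (is "_ \<le> card ?O")
proof -
  define r b :: "'a \<Rightarrow> 'a \<Rightarrow> nat" where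
    "r = (\<lambda>i j. of_bool (i \<noteq> j \<and> c {i, j} = Red))" and
    "b = (\<lambda>i j. of_bool (i \<noteq> j \<and> c {i, j} = Blue))"
  \<comment> \<open>\<open>h i j k\<close> indicates a bichromatic corner at the middle vertex
    \<open>j\<close>. It vanishes whenever two arguments coincide, so \<open>C\<close> can range
    over all triples and counts every such corner twice.\<close>
  define h where "h = (\<lambda>i j k. r i j * b j k + b i j * r j k)"
  define C where "C = (\<Sum>i\<in>V. \<Sum>j\<in>V. \<Sum>k\<in>V. h i j k)"
  have sum_card: "(\<Sum>i\<in>V. \<Sum>j\<in>V. \<Sum>k\<in>V. of_bool (P i j k))
      = card {(i, j, k). i \<in> V \<and> j \<in> V \<and> k \<in> V \<and> P i j k}" for P
  proof -
    have "{(i, j, k). i \<in> V \<and> j \<in> V \<and> k \<in> V \<and> P i j k}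
        = Sigma V (\<lambda>i. Sigma V (\<lambda>j. {k \<in> V. P i j k}))"
      by auto
    then show ?thesis
      using fin by (simp add: Int_def)
  qed
  have red_or_blue: "x = Red \<or> x = Blue" for x by (cases x) auto
  text \<open>A triangle that is not monochromatic has exactly two bichromatic corners.\<close>
  have pointwise: "2 * of_bool (i \<noteq> j \<and> j \<noteq> k \<and> i \<noteq> k)
      = 2 * of_bool (mono_triple c i j k) + h i j k + h j k i + h k i j" for i j k
    using red_or_blue[of "c {i, j}"] red_or_blue[of "c {j, k}"] red_or_blue[of "c {i, k}"]
    by (auto simp: h_def r_def b_def mono_triple_def insert_commute)
  have rotate: "(\<Sum>i\<in>V. \<Sum>j\<in>V. \<Sum>k\<in>V. g j k i) = (\<Sum>i\<in>V. \<Sum>j\<in>V. \<Sum>k\<in>V. g i j k)"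
    for g :: "'a \<Rightarrow> 'a \<Rightarrow> 'a \<Rightarrow> nat"
    by (subst sum.swap) (intro sum.cong refl sum.swap)
  \<comment> \<open>The corners at \<open>k\<close> and at \<open>i\<close> arise from the one at
    \<open>j\<close> by cyclic renaming, so each has total \<open>C\<close>.\<close>
  have C_rotated: "C = (\<Sum>i\<in>V. \<Sum>j\<in>V. \<Sum>k\<in>V. h j k i)"
      "C = (\<Sum>i\<in>V. \<Sum>j\<in>V. \<Sum>k\<in>V. h k i j)"
    unfolding C_def using rotate[of h] rotate[of "\<lambda>i j k. h k i j"] by simp_all
  have "(\<Sum>i\<in>V. \<Sum>j\<in>V. \<Sum>k\<in>V. 2 * of_bool (i \<noteq> j \<and> j \<noteq> k \<and> i \<noteq> k))
      = (\<Sum>i\<in>V. \<Sum>j\<in>V. \<Sum>k\<in>V. 2 * of_bool (mono_triple c i j k) + h i j k + h j k i + h k i j)"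
    by (intro sum.cong refl pointwise)
  also have "\<dots> = 2 * card ?O + 3 * C"
    using C_rotated sum_card[of "mono_triple c"]
    by (simp add: sum.distrib C_def flip: sum_distrib_left)
  finally have total: "2 * (2 * m * (2 * m - 1) * (2 * m - 2)) = 2 * card ?O + 3 * C"
    using sum_card[of "\<lambda>i j k. i \<noteq> j \<and> j \<noteq> k \<and> i \<noteq> k"] card_distinct_triples[OF fin]
    by (simp add: card flip: sum_distrib_left)
  define R B where "R = (\<lambda>j. \<Sum>k\<in>V. r j k)" and "B = (\<lambda>j. \<Sum>k\<in>V. b j k)"
  have symmetric: "r i j = r j i" "b i j = b j i" for i j
    by (auto simp: r_def b_def insert_commute)
  have degrees: "R j + B j + 1 = 2 * m" if "j \<in> V" for j
  proof -
    have "R j + B j = (\<Sum>k\<in>V. of_bool (k \<noteq> j))"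
      unfolding R_def B_def sum.distrib[symmetric]
      by (intro sum.cong refl) (use red_or_blue in \<open>auto simp: r_def b_def\<close>)
    also have "\<dots> = card (V - {j})"
      using fin by (simp add: of_bool_def sum.If_cases Diff_eq Compl_eq)
    finally show ?thesis
      using that fin card card_gt_0_iff[of V] by auto
  qed
  \<comment> \<open>Second count of \<open>C\<close>, grouped by the corner vertex: a bichromatic
    corner at \<open>j\<close> is a red neighbor paired with a blue one, in either order.\<close>
  have "C = (\<Sum>j\<in>V. \<Sum>i\<in>V. \<Sum>k\<in>V. h i j k)"
    unfolding C_def by (rule sum.swap)
  also have "\<dots> = (\<Sum>j\<in>V. R j * B j + B j * R j)"
    by (simp add: h_def R_def B_def sum.distrib sum_product symmetric)
  also have "\<dots> = (\<Sum>j\<in>V. 2 * (R j * B j))"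
    by (simp add: mult.commute mult_2)
  also have "\<dots> \<le> (\<Sum>j\<in>V. 2 * (m * (m - 1)))"
    by (intro sum_mono mult_left_mono mult_le_of_add_odd degrees) auto
  finally have "C \<le> 2 * m * (2 * (m * (m - 1)))" by (simp add: card)
  then have bound: "2 * (2 * m * (2 * m - 1) * (2 * m - 2)) \<le> 2 * card ?O + 12 * (m * m * (m - 1))"
    using total by simp
  then show ?thesis
  \<comment> \<open>For \<open>m < 2\<close> the claimed lower bound is 0; otherwise
    \<open>m = t + 2\<close> removes all truncated subtractions.\<close>
  proof (cases "m < 2")
    case False
    then obtain t where "m = Suc (Suc t)" by (metis add_2_eq_Suc le_Suc_ex not_less)
    then show ?thesis
      using bound by (simp add: algebra_simps)
  qed auto
qed

text \<open>The two adjacent swaps in \<open>sym\<close> generate all permutations of the arguments,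
  so every triple is one of six rearrangements of an increasing one.\<close>

lemma card_le_6_mult_card_increasing:
  fixes P :: "'a::linorder \<Rightarrow> 'a \<Rightarrow> 'a \<Rightarrow> bool"
  assumes fin: "finite V"
    and sym: "\<And>i j k. P i j k \<Longrightarrow> P j i k" "\<And>i j k. P i j k \<Longrightarrow> P i k j"
    and distinct: "\<And>i j k. P i j k \<Longrightarrow> i \<noteq> j"
  shows "card {(i, j, k). i \<in> V \<and> j \<in> V \<and> k \<in> V \<and> P i j k}
         \<le> 6 * card {(i, j, k). i \<in> V \<and> j \<in> V \<and> k \<in> V \<and> i < j \<and> j < k \<and> P i j k}"
    (is "card ?A \<le> 6 * card ?S")
proof -
  define perms :: "('a \<times> 'a \<times> 'a \<Rightarrow> 'a \<times> 'a \<times> 'a) list" where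
    "perms = [\<lambda>(i, j, k). (i, j, k), \<lambda>(i, j, k). (i, k, j), \<lambda>(i, j, k). (j, i, k),
              \<lambda>(i, j, k). (j, k, i), \<lambda>(i, j, k). (k, i, j), \<lambda>(i, j, k). (k, j, i)]"
  have fin_S: "finite ?S"
    by (rule finite_subset[of _ "V \<times> V \<times> V"]) (use fin in auto)
  have "?A \<subseteq> (\<Union>p\<in>set perms. p ` ?S)"
  proof
    fix x assume "x \<in> ?A"
    then obtain i j k where x: "x = (i, j, k)" and V: "i \<in> V" "j \<in> V" "k \<in> V" and P: "P i j k"
      by auto
    have all: "P i k j" "P j i k" "P j k i" "P k i j" "P k j i"
      using P sym by blast+
    then have "i \<noteq> j" "j \<noteq> k" "i \<noteq> k"
      using P distinct by blast+
    then consider "i < j" "j < k" | "i < k" "k < j" | "j < i" "i < k" | "j < k" "k < i"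
      | "k < i" "i < j" | "k < j" "j < i"
      by (meson linorder_less_linear)
    then show "x \<in> (\<Union>p\<in>set perms. p ` ?S)"
      by cases (use V P all x in \<open>force simp: perms_def image_iff\<close>)+
  qed
  then have "card ?A \<le> card (\<Union>p\<in>set perms. p ` ?S)"
    using fin_S by (intro card_mono) auto
  also have "\<dots> \<le> (\<Sum>p\<in>set perms. card (p ` ?S))"
    by (rule card_UN_le) simp
  also have "\<dots> \<le> (\<Sum>p\<in>set perms. card ?S)"
    using fin_S by (intro sum_mono card_image_le)
  \<comment> \<open>The length of the list bounds the size of its set, so the six maps need not be
    shown distinct.\<close>
  also have "\<dots> \<le> 6 * card ?S"
    using card_length[of perms] by (simp add: perms_def)
  finally show ?thesis .
qed

lemma contains_diamondI:
  assumes "a \<in> {1..n}" "d \<in> {1..n}" "a < b" "b < c" "c < d"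
    and colors: "\<chi> {b, c} = col" "\<chi> {b, d} = col" "\<chi> {c, d} = col" "\<chi> {a, c} = col" "\<chi> {a, d} = col"
  shows "contains_in_color n \<chi> col (vl_ordering diamond d1 2)"
proof -
  \<comment> \<open>The degree-2 vertices go to \<open>a\<close> and \<open>b\<close>, so the pair
    \<open>{a, b}\<close>, whose color is unknown, becomes the missing edge; \<open>d1\<close> takes
    \<open>b\<close>, the second smallest.\<close>
  define f where "f = (\<lambda>v. case v of d1 \<Rightarrow> b | d2 \<Rightarrow> c | d3 \<Rightarrow> d | d4 \<Rightarrow> a)"
  have f [simp]: "f d1 = b" "f d2 = c" "f d3 = d" "f d4 = a"
    by (simp_all add: f_def)
  have image: "f ` verts diamond = {a, b, c, d}"
    by (auto simp: diamond_def)
  have "sorted_list_of_set (set [a, b, c, d]) = [a, b, c, d]"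
    using assms(3-5) by (subst sorted_list_of_set.idem_if_sorted_distinct) auto
  then have sorted: "sorted_list_of_set {a, b, c, d} = [a, b, c, d]"
    by simp
  have "inj_on f (verts diamond)"
    using assms(3-5) by (auto simp: diamond_def inj_on_def)
  moreover have "f ` verts diamond \<subseteq> {1..n}"
    using assms(1-5) by (auto simp: image)
  moreover have "\<forall>e\<in>edges diamond. \<chi> (f ` e) = col"
    using colors by (auto simp: diamond_def insert_commute)
  moreover
  \<comment> \<open>Only \<open>d1\<close> carries a label, so only the position of \<open>b\<close>
    has to be checked.\<close>
  have "i = 2" if "i \<in> {1..4}" "b = [a, b, c, d] ! (i - 1)" for i
  proof -
    have "i = 1 \<or> i = 2 \<or> i = 3 \<or> i = 4" using that(1) by auto
    then show ?thesis using that(2) assms(3-5) by auto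
  qed
  then have "\<forall>i\<in>{1..4}. \<forall>v\<in>verts diamond. f v = [a, b, c, d] ! (i - 1) \<longrightarrow>
      [d1 \<mapsto> 2] v = Some i \<or> [d1 \<mapsto> 2] v = None"
    by auto
  moreover have "card (verts diamond) = 4"
    by (simp add: diamond_def)
  ultimately show ?thesis
    unfolding contains_in_color_def vl_ordering_def graph.simps ordering.simps image sorted
    by (intro exI[of _ f]) (simp only: image sorted simp_thms)
qed

lemma exists_contains_diamond:
  "\<exists>col. contains_in_color 16 c col (vl_ordering diamond d1 2)"
proof (rule ccontr)
  assume none: "\<not> ?thesis"
  define V where "V = {1..16::nat}"
  define S where "S = {(i, j, k). i \<in> V \<and> j \<in> V \<and> k \<in> V \<and> i < j \<and> j < k \<and> mono_triple c i j k}"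
  \<comment> \<open>Candidates for the two largest vertices of a triangle; \<open>j\<close> starts
    at 2 to leave room for a smaller vertex.\<close>
  define E where "E = Sigma {2..16::nat} (\<lambda>j. {j<..16})"
  have no_pair: False
    if "(i, j, k) \<in> S" "(i', j, k) \<in> S" "i < i'" for i i' j k
  proof -
    have "contains_in_color 16 c (c {j, k}) (vl_ordering diamond d1 2)"
      by (rule contains_diamondI[of i _ k i' j])
        (use that in \<open>auto simp: S_def V_def mono_triple_def insert_commute\<close>)
    then show False using none by blast
  qed
  \<comment> \<open>\<open>snd\<close> forgets the smallest vertex \<open>i\<close> and keeps
    \<open>(j, k)\<close>.\<close>
  have "inj_on snd S"
  proof (rule inj_onI)
    fix x y assume "x \<in> S" "y \<in> S" "snd x = snd y"
    then show "x = y"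
      using no_pair by (cases x; cases y) (metis linorder_neqE_nat snd_conv)
  qed
  moreover have "snd ` S \<subseteq> E"
    by (auto simp: S_def V_def E_def)
  ultimately have "card S \<le> card E"
    by (intro card_inj_on_le[of snd]) (auto simp: E_def)
  also have "card E = 105"
    by (simp add: E_def numeral_eq_Suc)
  finally have "6 * card S \<le> 630" by simp
  moreover have "card {(i, j, k). i \<in> V \<and> j \<in> V \<and> k \<in> V \<and> mono_triple c i j k} \<le> 6 * card S"
    unfolding S_def
    by (rule card_le_6_mult_card_increasing)
      (auto simp: V_def mono_triple_def insert_commute)
  \<comment> \<open>Here \<open>m = 8\<close>, and \<open>2 * 8 * 7 * 6 = 672\<close> exceeds
    \<open>6 * 105 = 630\<close>.\<close>
  moreover have "672 \<le> card {(i, j, k). i \<in> V \<and> j \<in> V \<and> k \<in> V \<and> mono_triple c i j k}"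
    using goodman[of V 8 c] by (simp add: V_def)
  ultimately show False by simp
qed

theorem theorem3p8:
  shows "R\<^sub>< (vl_ordering diamond d1 2) \<le> 16"
  unfolding ordered_ramsey_def
  by (rule Inf_lower) (use exists_contains_diamond in \<open>auto simp: numeral_eq_enat\<close>)

end
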